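(* For every positive integer $n$, $$|\mathcal{B}_n| = \sum_{n = \sum_{i=1}^{p}n_ik_i} \frac{1}{n_1!\,n_2!\cdots n_p!}\binom{n}{k_1(n_1),k_2(n_2),\ldots,k_p(n_p)}\, |\mathcal{C}_{k_1}|^{n_1}\,|\mathcal{C}_{k_2}|^{n_2}\cdots|\mathcal{C}_{k_p}|^{n_p},$$ where the sum is over all expansions $n=\sum_{i=1}^{p}n_ik_i$ of $n$ as a linear combination, with positive integer coefficients $n_1,\ldots,n_p$, of $p>0$ different integer values $k_1 > k_2 > \cdots > k_p > 0$.
   Context: For a finite set $N$, $\mathcal{A}_N$ denotes the set of antichains in $N$: sets $\alpha \subseteq 2^N$ such that no two distinct members of $\alpha$ are in a subset/superset relationship. Order: $\alpha \le \beta$ iff for every $A \in \alpha$ there is $B \in \beta$ with $A \subseteq B$. The basic interval of dimension $n$ is $\mathcal{B}_n=\{\alpha\in\mathcal{A}_{\{1,\ldots,n\}} : \{\{1\},\ldots,\{n\}\}\le\alpha\}$. For $k\geq 1$, $\mathcal{C}_k$ is the set of antichains $\alpha\in\mathcal{B}_k$ such that the graph with vertex set $\{1,\ldots,k\}$, in which two distinct elements are adjacent iff they are together in at least one member of $\alpha$, is connected. In the multinomial coefficient, $k(c)$ indicates $c$-fold repetition of the number $k$, e.g. $\binom{5}{2(2),1(1)}=\binom{5}{2,2,1}$. *)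

theory Defs
  imports Complex_Main "Graph_Theory.Graph_Theory"
begin

definition antichains :: "'a set \<Rightarrow> 'a set set set" where
  "antichains N = {\<alpha>. \<alpha> \<subseteq> Pow N \<and> (\<forall>A\<in>\<alpha>. \<forall>B\<in>\<alpha>. A \<subseteq> B \<longrightarrow> A = B)}"

definition antichain_le :: "'a set set \<Rightarrow> 'a set set \<Rightarrow> bool" where
  "antichain_le \<alpha> \<beta> \<longleftrightarrow> (\<forall>A\<in>\<alpha>. \<exists>B\<in>\<beta>. A \<subseteq> B)"

definition basic_interval :: "nat \<Rightarrow> nat set set set" where
  "basic_interval n =
     {\<alpha> \<in> antichains {1..n}. antichain_le ((\<lambda>i. {i}) ` {1..n}) \<alpha>}"

text \<open>The undirected graph is represented, as usual in \<^theory>\<open>Graph_Theory.Graph_Theory\<close>,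
  by a symmetric loop-free pair digraph.\<close>

definition antichain_graph :: "nat \<Rightarrow> nat set set \<Rightarrow> nat pair_pre_digraph" where
  "antichain_graph k \<alpha> =
     \<lparr>pverts = {1..k},
      parcs = {(i, j). i \<in> {1..k} \<and> j \<in> {1..k} \<and> i \<noteq> j \<and> (\<exists>A\<in>\<alpha>. i \<in> A \<and> j \<in> A)}\<rparr>"

lemma pair_graph_antichain_graph: "pair_graph (antichain_graph k \<alpha>)"
proof
  have "parcs (antichain_graph k \<alpha>) \<subseteq> {1..k} \<times> {1..k}"
    by (auto simp: antichain_graph_def)
  then show "finite (parcs (antichain_graph k \<alpha>))"
    by (rule finite_subset) simp
  show "symmetric (with_proj (antichain_graph k \<alpha>))"
    by (auto simp: antichain_graph_def symmetric_def sym_def)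
qed (auto simp: antichain_graph_def)

definition connected_antichains :: "nat \<Rightarrow> nat set set set" where
  "connected_antichains k =
     {\<alpha> \<in> basic_interval k. connected (with_proj (antichain_graph k \<alpha>))}"

text \<open>Only meaningful if the entries of the list sum up to \<open>n\<close>; the division is the one
  on reals, so nothing is truncated.\<close>

definition multinomial :: "nat \<Rightarrow> nat list \<Rightarrow> real" where
  "multinomial n ks = fact n / (\<Prod>k\<leftarrow>ks. fact k)"

text \<open>An expansion of \<open>n\<close> as \<open>n\<^sub>1 k\<^sub>1 + \<dots> + n\<^sub>p k\<^sub>p\<close>
  is the list \<open>[(n\<^sub>1, k\<^sub>1), \<dots>, (n\<^sub>p, k\<^sub>p)]\<close>.\<close>

definition expansions :: "nat \<Rightarrow> (nat \<times> nat) list set" where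
  "expansions n =
     {e. e \<noteq> [] \<and> sorted_wrt (>) (map snd e) \<and> (\<forall>(m, k) \<in> set e. m > 0 \<and> k > 0) \<and>
         n = (\<Sum>(m, k)\<leftarrow>e. m * k)}"

lemma finite_expansions: "finite (expansions n)"
proof (rule finite_subset)
  have "set e \<subseteq> {1..n} \<times> {1..n} \<and> length e \<le> n"
    if "\<forall>(m, k) \<in> set e. m > 0 \<and> k > 0" "(\<Sum>(m, k)\<leftarrow>e. m * k) \<le> n" for e n
    using that
  proof (induction e arbitrary: n)
    case (Cons x e)
    obtain m k where x: "x = (m, k)" by (cases x)
    have mk: "m > 0" "k > 0" using Cons.prems x by auto
    then have le: "m \<le> m * k" "k \<le> m * k" "1 \<le> m * k" by simp_all
    have sum: "m * k + (\<Sum>(m, k)\<leftarrow>e. m * k) \<le> n" using Cons.prems x by simp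
    then have "(\<Sum>(m, k)\<leftarrow>e. m * k) \<le> n - m * k" by linarith
    then have IH: "set e \<subseteq> {1..n - m * k} \<times> {1..n - m * k}" "length e \<le> n - m * k"
      using Cons by auto
    have "{1..n - m * k} \<subseteq> {1..n}" by simp
    with IH have "set e \<subseteq> {1..n} \<times> {1..n}" by blast
    moreover have "m \<in> {1..n}" "k \<in> {1..n}" "length (x # e) \<le> n"
      unfolding atLeastAtMost_iff list.size using mk le sum IH(2) by linarith+
    ultimately show ?case by (simp add: x)
  qed simp
  then show "expansions n \<subseteq> {e. set e \<subseteq> {1..n} \<times> {1..n} \<and> length e \<le> n}"
    unfolding expansions_def by auto
  show "finite {e. set e \<subseteq> {1..n} \<times> {1..n} \<and> length e \<le> n}"
    by (intro finite_lists_length_le finite_cartesian_product) auto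
qed

end

theory Submission
  imports Defs "HOL-Library.Multiset"
begin

text \<open>Fixing a vertex \<open>v\<close>, an antichain covering a nonempty \<open>V\<close> splits uniquely into the
  connected antichain on the component \<open>S\<close> of \<open>v\<close> and an arbitrary covering antichain on
  \<open>V - S\<close>. With \<open>x\<^sub>k = |C\<^sub>k| / k!\<close> and \<open>y\<^sub>n = |B\<^sub>n| / n!\<close> this says
  \<open>n y\<^sub>n = (\<Sum>k. k x\<^sub>k y\<^sub>n\<^sub>-\<^sub>k)\<close>, the recurrence for the coefficients of
  \<open>exp (\<Sum>k. x\<^sub>k t\<^sup>k)\<close>. An expansion of \<open>n\<close> is a multiset of positive integers
  with sum \<open>n\<close>, and marking one part of such a multiset shows that the right-hand side
  satisfies the same recurrence.\<close>

section \<open>Covering antichains and connectedness\<close>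

text \<open>The member \<open>{}\<close> is excluded so that there is exactly one covering of \<open>{}\<close>; in contrast,
  \<open>basic_interval 0\<close> has the two elements \<open>{}\<close> and \<open>{{}}\<close>.\<close>

definition coverings :: "'a set \<Rightarrow> 'a set set set" where
  "coverings V = {\<alpha> \<in> antichains V. {} \<notin> \<alpha> \<and> \<Union>\<alpha> = V}"

text \<open>Loops are kept, unlike in \<open>antichain_graph\<close>: the closure taken later is
  reflexive anyway, and any map of points then carries related points to related points.\<close>

definition co_member :: "'a set set \<Rightarrow> 'a rel" where
  "co_member \<alpha> = {(u, w). \<exists>A\<in>\<alpha>. u \<in> A \<and> w \<in> A}"

definition connected_coverings :: "'a set \<Rightarrow> 'a set set set" where
  "connected_coverings V = {\<alpha> \<in> coverings V. \<forall>u\<in>V. \<forall>w\<in>V. (u, w) \<in> (co_member \<alpha>)\<^sup>*}"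

lemma finite_coverings: "finite V \<Longrightarrow> finite (coverings V)"
  by (rule finite_subset[of _ "Pow (Pow V)"]) (auto simp: coverings_def antichains_def)

lemma finite_connected_coverings: "finite V \<Longrightarrow> finite (connected_coverings V)"
  by (rule finite_subset[OF _ finite_coverings]) (auto simp: connected_coverings_def)

lemma coverings_empty: "coverings {} = {{}}"
  by (auto simp: coverings_def antichains_def)

text \<open>The order condition says that every point lies in some member. As \<open>n > 0\<close>,
  some member is nonempty; it includes \<open>{}\<close> as a subset, so the antichain property bars
  \<open>{}\<close> from being a member.\<close>

lemma basic_interval_eq_coverings:
  assumes "n > 0"
  shows "basic_interval n = coverings {1..n}"
proof -
  have "{} \<notin> \<alpha> \<and> \<Union>\<alpha> = {1..n}" if a: "\<alpha> \<in> antichains {1..n}"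
    and le: "antichain_le ((\<lambda>i. {i}) ` {1..n}) \<alpha>" for \<alpha>
  proof -
    have "\<exists>B\<in>\<alpha>. i \<in> B" if "i \<in> {1..n}" for i
      using le that unfolding antichain_le_def by blast
    moreover have "\<Union>\<alpha> \<subseteq> {1..n}" using a unfolding antichains_def by blast
    ultimately have U: "\<Union>\<alpha> = {1..n}" by blast
    have "1 \<in> \<Union>\<alpha>" using assms unfolding U by simp
    then obtain B where "B \<in> \<alpha>" "1 \<in> B" by (rule UnionE)
    then have "{} \<notin> \<alpha>" using a by (auto simp: antichains_def)
    with U show ?thesis by blast
  qed
  then show ?thesis
    by (auto simp: basic_interval_def coverings_def antichain_le_def)
qed

text \<open>All members lie in \<open>{1..k}\<close>, so the arcs are exactly the off-diagonal pairs
  of \<open>co_member\<close>, and a reflexive closure does not see the diagonal. Confining paths to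
  the vertex set changes nothing when the endpoints lie in it.\<close>

lemma reachable_antichain_graph_iff:
  assumes "u \<in> {1..k}" "w \<in> {1..k}" "\<alpha> \<in> antichains {1..k}"
  shows "u \<rightarrow>\<^sup>*\<^bsub>with_proj (antichain_graph k \<alpha>)\<^esub> w \<longleftrightarrow> (u, w) \<in> (co_member \<alpha>)\<^sup>*"
proof -
  let ?R = "parcs (antichain_graph k \<alpha>)"
  have "u \<in> {1..k}" if "A \<in> \<alpha>" "u \<in> A" for A u
    using assms(3) that unfolding antichains_def by blast
  then have R: "?R = co_member \<alpha> - Id"
    unfolding antichain_graph_def co_member_def pair_pre_digraph.simps by blast
  have "(u, w) \<in> rtrancl_on {1..k} ?R \<longleftrightarrow> (u, w) \<in> ?R\<^sup>*"
  proof
    assume "(u, w) \<in> ?R\<^sup>*"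
    then show "(u, w) \<in> rtrancl_on {1..k} ?R"
      by (rule rtrancl_consistent_rtrancl_on) (use assms in \<open>auto simp: antichain_graph_def\<close>)
  qed (rule rtrancl_on_rtranclI)
  then show ?thesis
    by (simp add: reachable_def R rtrancl_r_diff_Id) (simp add: antichain_graph_def)
qed

lemma connected_antichains_eq_connected_coverings:
  assumes "k > 0"
  shows "connected_antichains k = connected_coverings {1..k}"
proof -
  have "connected (with_proj (antichain_graph k \<alpha>)) \<longleftrightarrow>
      (\<forall>u\<in>{1..k}. \<forall>w\<in>{1..k}. (u, w) \<in> (co_member \<alpha>)\<^sup>*)"
    if "\<alpha> \<in> antichains {1..k}" for \<alpha>
  proof -
    interpret pair_graph "antichain_graph k \<alpha>" by (rule pair_graph_antichain_graph)
    have "connected (with_proj (antichain_graph k \<alpha>)) \<longleftrightarrow>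
      (\<forall>u\<in>{1..k}. \<forall>w\<in>{1..k}. u \<rightarrow>\<^sup>*\<^bsub>with_proj (antichain_graph k \<alpha>)\<^esub> w)"
      \<comment> \<open>Connectedness is strong connectivity of the symmetric closure; the digraph
        is already symmetric, so reachability is unchanged. \<open>k > 0\<close> supplies the
        nonempty vertex set that strong connectivity demands.\<close>
      unfolding connected_def strongly_connected_def
        reachable_mk_symmetric_eq[OF sym_arcs]
      using assms by (simp add: antichain_graph_def)
    then show ?thesis
      using reachable_antichain_graph_iff[OF _ _ that] by (metis (no_types, lifting))
  qed
  then show ?thesis
    unfolding connected_antichains_def connected_coverings_def basic_interval_eq_coverings[OF assms]
    by (auto simp: coverings_def)
qed

section \<open>Invariance under relabelling of the points\<close>

lemma image_coverings:
  assumes "inj_on f V" "\<alpha> \<in> coverings V"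
  shows "(`) f ` \<alpha> \<in> coverings (f ` V)"
proof -
  have sub: "A \<subseteq> V" if "A \<in> \<alpha>" for A
    using assms(2) that by (auto simp: coverings_def antichains_def)
  have "A = B" if "A \<in> \<alpha>" "B \<in> \<alpha>" "f ` A \<subseteq> f ` B" for A B
  proof -
    have "A \<subseteq> B"
      using that(3) sub[OF that(1)] sub[OF that(2)] assms(1) by (metis inj_on_image_mem_iff subset_iff image_eqI)
    then show ?thesis using assms(2) that by (auto simp: coverings_def antichains_def)
  qed
  then have "(`) f ` \<alpha> \<in> antichains (f ` V)"
    using sub unfolding antichains_def by blast
  moreover have "{} \<notin> (`) f ` \<alpha>" "\<Union>((`) f ` \<alpha>) = f ` V"
    using assms(2) by (auto simp: coverings_def)
  ultimately show ?thesis by (simp add: coverings_def)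
qed

lemma image_connected_coverings:
  assumes "inj_on f V" "\<alpha> \<in> connected_coverings V"
  shows "(`) f ` \<alpha> \<in> connected_coverings (f ` V)"
proof -
  have "(f u, f w) \<in> (co_member ((`) f ` \<alpha>))\<^sup>*" if "(u, w) \<in> (co_member \<alpha>)\<^sup>*" for u w
    using that
  proof induction
    case (step y z)
    then have "(f y, f z) \<in> co_member ((`) f ` \<alpha>)" by (auto simp: co_member_def)
    with step.IH show ?case by (rule rtrancl_into_rtrancl)
  qed simp
  then show ?thesis
    using assms image_coverings[OF assms(1)] by (auto simp: connected_coverings_def)
qed

lemma inj_on_image_image:
  assumes "inj_on f V"
  shows "inj_on (\<lambda>\<alpha>. (`) f ` \<alpha>) (Pow (Pow V))"
  using inj_on_image_Pow[OF inj_on_image_Pow[OF assms]] .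

lemma coverings_subset: "coverings V \<subseteq> Pow (Pow V)"
  by (auto simp: coverings_def antichains_def)

lemma connected_coverings_subset: "connected_coverings V \<subseteq> Pow (Pow V)"
  using coverings_subset by (auto simp: connected_coverings_def)

lemma card_le_of_image_image:
  assumes "inj_on f V" "X \<subseteq> Pow (Pow V)" "\<And>\<alpha>. \<alpha> \<in> X \<Longrightarrow> (`) f ` \<alpha> \<in> Y" "finite Y"
  shows "card X \<le> card Y"
  using assms by (intro card_inj_on_le[OF inj_on_subset[OF inj_on_image_image]]) auto

lemma card_coverings_eq:
  assumes "finite V" "finite W" "card V = card W"
  shows "card (coverings V) = card (coverings W)"
proof -
  \<comment> \<open>Stated for arbitrary types, so that it applies again with the two sets
    exchanged.\<close>
  have le: "card (coverings V) \<le> card (coverings W)"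
    if VW: "finite V" "finite W" "card V = card W" for V :: "'c set" and W :: "'d set"
  proof -
    obtain f where "bij_betw f V W" using finite_same_card_bij[OF VW] by blast
    then show ?thesis
      using card_le_of_image_image[OF _ coverings_subset, of f V "coverings W"]
        image_coverings[of f V] finite_coverings[OF VW(2)]
      by (auto simp: bij_betw_def)
  qed
  show ?thesis
    using le[OF assms] le[OF assms(2,1) assms(3)[symmetric]] by simp
qed

lemma card_connected_coverings_eq:
  assumes "finite V" "finite W" "card V = card W"
  shows "card (connected_coverings V) = card (connected_coverings W)"
proof -
  have le: "card (connected_coverings V) \<le> card (connected_coverings W)"
    if VW: "finite V" "finite W" "card V = card W" for V :: "'c set" and W :: "'d set"
  proof -
    obtain f where "bij_betw f V W" using finite_same_card_bij[OF VW] by blast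
    then show ?thesis
      using card_le_of_image_image[OF _ connected_coverings_subset, of f V "connected_coverings W"]
        image_connected_coverings[of f V] finite_connected_coverings[OF VW(2)]
      by (auto simp: bij_betw_def)
  qed
  show ?thesis
    using le[OF assms] le[OF assms(2,1) assms(3)[symmetric]] by simp
qed

section \<open>Splitting off the component of a vertex\<close>

text \<open>Members from different sides are disjoint and nonempty, hence incomparable. Here the
  exclusion of \<open>{}\<close> matters.\<close>

lemma Un_coverings:
  assumes "\<beta> \<in> coverings S" "\<gamma> \<in> coverings T" "S \<inter> T = {}"
  shows "\<beta> \<union> \<gamma> \<in> coverings (S \<union> T)"
proof -
  have "\<not> A \<subseteq> B \<and> \<not> B \<subseteq> A" if "A \<in> \<beta>" "B \<in> \<gamma>" for A B
  proof -
    have "A \<inter> B = {}" "A \<noteq> {}" "B \<noteq> {}"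
      using assms that by (auto simp: coverings_def)
    then show ?thesis by blast
  qed
  with assms(1,2) show ?thesis
    by (auto simp: coverings_def antichains_def)
qed

text \<open>No member meets both \<open>S\<close> and \<open>T\<close>, so a path from
  \<open>v\<close> never leaves \<open>S\<close>; conversely \<open>\<beta>\<close> alone already
  joins \<open>v\<close> to all of \<open>S\<close>.\<close>

lemma component_Un_coverings:
  assumes "\<beta> \<in> connected_coverings S" "\<gamma> \<in> coverings T" "S \<inter> T = {}" "v \<in> S"
  shows "(co_member (\<beta> \<union> \<gamma>))\<^sup>* `` {v} = S"
proof
  have "w \<in> S" if "(v, w) \<in> (co_member (\<beta> \<union> \<gamma>))\<^sup>*" for w
    using that
  proof induction
    case (step y z)
    then show ?case
      using assms by (auto simp: co_member_def connected_coverings_def coverings_def)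
  qed (rule assms)
  then show "(co_member (\<beta> \<union> \<gamma>))\<^sup>* `` {v} \<subseteq> S" by blast
  have "(co_member \<beta>)\<^sup>* \<subseteq> (co_member (\<beta> \<union> \<gamma>))\<^sup>*"
    by (rule rtrancl_mono) (auto simp: co_member_def)
  then show "S \<subseteq> (co_member (\<beta> \<union> \<gamma>))\<^sup>* `` {v}"
    using assms(1,4) by (auto simp: connected_coverings_def)
qed

text \<open>The elements of one member are mutually related, so a member meeting the component
  \<open>S\<close> lies inside it. Every member therefore lies in \<open>S\<close> or in
  \<open>V - S\<close>.\<close>

lemma split_coverings_at_component:
  fixes \<alpha> :: "'a set set"
  assumes "\<alpha> \<in> coverings V" "v \<in> V"
  defines "S \<equiv> (co_member \<alpha>)\<^sup>* `` {v}"
  shows "S \<subseteq> V" "v \<in> S" "\<alpha> \<inter> Pow S \<in> connected_coverings S" "\<alpha> \<inter> Pow (V - S) \<in> coverings (V - S)"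
    "\<alpha> = (\<alpha> \<inter> Pow S) \<union> (\<alpha> \<inter> Pow (V - S))"
proof -
  have U: "\<Union>\<alpha> = V" using assms(1) by (auto simp: coverings_def)
  show "v \<in> S" by (simp add: S_def)
  have "w \<in> V" if "(v, w) \<in> (co_member \<alpha>)\<^sup>*" for w
    using that by induction (use assms(2) U in \<open>auto simp: co_member_def\<close>)
  then show SV: "S \<subseteq> V" by (auto simp: S_def)
  have closed: "A \<subseteq> S" if "A \<in> \<alpha>" "u \<in> A" "u \<in> S" for A u
    using that unfolding S_def by (auto simp: co_member_def intro: rtrancl_into_rtrancl)
  have sub: "A \<subseteq> S \<or> A \<subseteq> V - S" if "A \<in> \<alpha>" for A
    using closed[OF that] U that by blast
  then show "\<alpha> = (\<alpha> \<inter> Pow S) \<union> (\<alpha> \<inter> Pow (V - S))" by blast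
  have "\<Union>(\<alpha> \<inter> Pow (V - S)) = V - S" using sub U by blast
  then show "\<alpha> \<inter> Pow (V - S) \<in> coverings (V - S)"
    using assms(1) by (auto simp: coverings_def antichains_def)
  have "\<Union>(\<alpha> \<inter> Pow S) = S" using closed U SV by blast
  then have "\<alpha> \<inter> Pow S \<in> coverings S"
    using assms(1) by (auto simp: coverings_def antichains_def)
  \<comment> \<open>Each step of a path from \<open>v\<close> takes place in a member that meets
    \<open>S\<close> and hence lies in \<open>S\<close>, so the path survives the
    restriction.\<close>
  moreover have "(v, w) \<in> (co_member (\<alpha> \<inter> Pow S))\<^sup>*" if "(v, w) \<in> (co_member \<alpha>)\<^sup>*" for w
    using that
  proof induction
    case (step y z)
    then obtain A where "A \<in> \<alpha>" "y \<in> A" "z \<in> A" by (auto simp: co_member_def)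
    moreover have "A \<subseteq> S" using step.hyps calculation closed by (auto simp: S_def)
    ultimately have "(y, z) \<in> co_member (\<alpha> \<inter> Pow S)" by (auto simp: co_member_def)
    with step.IH show ?case by (rule rtrancl_into_rtrancl)
  qed simp
  \<comment> \<open>By symmetry, any two points of \<open>S\<close> are joined by a path through
    \<open>v\<close>.\<close>
  moreover have "sym ((co_member (\<alpha> \<inter> Pow S))\<^sup>*)"
    by (rule sym_rtrancl) (auto simp: sym_def co_member_def)
  ultimately show "\<alpha> \<inter> Pow S \<in> connected_coverings S"
    unfolding connected_coverings_def S_def
    by (auto dest: symD intro: rtrancl_trans)
qed

lemma bij_betw_component_decomposition:
  assumes "v \<in> V"
  shows "bij_betw (\<lambda>(S, \<beta>, \<gamma>). \<beta> \<union> \<gamma>)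
    (SIGMA S:{S. S \<subseteq> V \<and> v \<in> S}. connected_coverings S \<times> coverings (V - S)) (coverings V)"
proof -
  let ?D = "SIGMA S:{S. S \<subseteq> V \<and> v \<in> S}. connected_coverings S \<times> coverings (V - S)"
  define S' where "S' \<alpha> = (co_member \<alpha>)\<^sup>* `` {v}" for \<alpha>
  \<comment> \<open>The triple is recovered from the union: \<open>S\<close> as the component of
    \<open>v\<close>, then \<open>\<beta>\<close> and \<open>\<gamma>\<close> as the members inside
    \<open>S\<close> and inside its complement.\<close>
  have inj: "S' (\<beta> \<union> \<gamma>) = S" "(\<beta> \<union> \<gamma>) \<inter> Pow S = \<beta>" "(\<beta> \<union> \<gamma>) \<inter> Pow (V - S) = \<gamma>"
    if "(S, \<beta>, \<gamma>) \<in> ?D" for S \<beta> \<gamma>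
  proof -
    have mem: "\<beta> \<in> connected_coverings S" "\<gamma> \<in> coverings (V - S)" "v \<in> S" using that by auto
    show "S' (\<beta> \<union> \<gamma>) = S" using component_Un_coverings[OF mem(1,2) _ mem(3)] by (simp add: S'_def)
    have U: "\<Union>\<beta> = S" "\<Union>\<gamma> = V - S" "{} \<notin> \<beta>" "{} \<notin> \<gamma>"
      using mem by (simp_all add: connected_coverings_def coverings_def)
    \<comment> \<open>Nonemptiness is what keeps a member from lying in both \<open>S\<close> and
      \<open>V - S\<close>.\<close>
    have \<beta>: "A \<subseteq> S \<and> \<not> A \<subseteq> V - S" if "A \<in> \<beta>" for A
    proof -
      have "A \<noteq> {}" "A \<subseteq> S" using U that by auto
      then show ?thesis by blast
    qed
    have \<gamma>: "A \<subseteq> V - S \<and> \<not> A \<subseteq> S" if "A \<in> \<gamma>" for A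
    proof -
      have "A \<noteq> {}" "A \<subseteq> V - S" using U that by auto
      then show ?thesis by blast
    qed
    show "(\<beta> \<union> \<gamma>) \<inter> Pow S = \<beta>" using \<beta> \<gamma> by blast
    show "(\<beta> \<union> \<gamma>) \<inter> Pow (V - S) = \<gamma>" using \<beta> \<gamma> by blast
  qed
  have Un: "\<beta> \<union> \<gamma> \<in> coverings V" if "(S, \<beta>, \<gamma>) \<in> ?D" for S \<beta> \<gamma>
  proof -
    have "\<beta> \<in> coverings S" "\<gamma> \<in> coverings (V - S)"
      using that by (auto simp: connected_coverings_def)
    from Un_coverings[OF this] show ?thesis using that by (simp add: Un_absorb1)
  qed
  have split: "(S' \<alpha>, \<alpha> \<inter> Pow (S' \<alpha>), \<alpha> \<inter> Pow (V - S' \<alpha>)) \<in> ?D"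
      "\<alpha> = (\<alpha> \<inter> Pow (S' \<alpha>)) \<union> (\<alpha> \<inter> Pow (V - S' \<alpha>))" if "\<alpha> \<in> coverings V" for \<alpha>
    using split_coverings_at_component[OF that assms] unfolding S'_def by blast+
  show ?thesis
  proof (intro bij_betw_byWitness[where f' = "\<lambda>\<alpha>. (S' \<alpha>, \<alpha> \<inter> Pow (S' \<alpha>), \<alpha> \<inter> Pow (V - S' \<alpha>))"]
      ballI subsetI, goal_cases)
    case (1 x)
    then show ?case using inj by (cases x) (simp only: prod.case)
  next
    case (2 \<alpha>)
    then show ?case unfolding prod.case using split(2) by metis
  next
    case (3 \<alpha>)
    then obtain S \<beta> \<gamma> where "(S, \<beta>, \<gamma>) \<in> ?D" "\<alpha> = \<beta> \<union> \<gamma>" by auto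
    then show ?case using Un[of S \<beta> \<gamma>] by simp
  next
    case (4 x)
    then show ?case using split(1) by blast
  qed
qed

section \<open>The recurrence for the number of coverings\<close>

lemma card_coverings_eq_sum:
  assumes "finite V" "v \<in> V"
  shows "card (coverings V) =
    (\<Sum>S | S \<subseteq> V \<and> v \<in> S. card (connected_coverings S) * card (coverings (V - S)))"
proof -
  have "card (coverings V) =
      card (SIGMA S:{S. S \<subseteq> V \<and> v \<in> S}. connected_coverings S \<times> coverings (V - S))"
    using bij_betw_same_card[OF bij_betw_component_decomposition[OF assms(2)]] by simp
  also have "\<dots> = (\<Sum>S | S \<subseteq> V \<and> v \<in> S. card (connected_coverings S \<times> coverings (V - S)))"
    using assms(1)
    by (intro card_SigmaI)
      (auto intro!: finite_cartesian_product finite_coverings finite_connected_coverings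
        dest: finite_subset)
  finally show ?thesis by (simp add: card_cartesian_product)
qed

text \<open>Summing the decomposition over all choices of the base point \<open>v\<close> counts each
  component \<open>S\<close> exactly \<open>card S\<close> times.\<close>

lemma card_coverings_recurrence:
  "n * card (coverings {1..n}) =
    (\<Sum>k\<le>n. (n choose k) * (k * card (connected_coverings {1..k}) * card (coverings {1..n - k})))"
proof -
  let ?V = "{1..n}"
  let ?c = "\<lambda>k. card (connected_coverings {1..k})" and ?b = "\<lambda>k. card (coverings {1..k})"
  \<comment> \<open>By relabelling, both factors depend only on the sizes of \<open>S\<close> and
    its complement.\<close>
  have summand: "card (connected_coverings S) * card (coverings (?V - S)) = ?c (card S) * ?b (n - card S)"
    if "S \<subseteq> ?V" for S
  proof -
    have "finite S" using that by (rule finite_subset) simp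
    then show ?thesis
      using that card_connected_coverings_eq[of S "{1..card S}"]
        card_coverings_eq[of "?V - S" "{1..n - card S}"]
      by (simp add: card_Diff_subset)
  qed
  have "n * ?b n = (\<Sum>v\<in>?V. ?b n)" by simp
  also have "\<dots> = (\<Sum>v\<in>?V. \<Sum>S | S \<subseteq> ?V \<and> v \<in> S. ?c (card S) * ?b (n - card S))"
  proof (rule sum.cong)
    fix v assume "v \<in> ?V"
    then show "?b n = (\<Sum>S | S \<subseteq> ?V \<and> v \<in> S. ?c (card S) * ?b (n - card S))"
      using card_coverings_eq_sum[of ?V v] summand by simp
  qed simp
  also have "\<dots> = (\<Sum>v\<in>?V. \<Sum>S | S \<in> Pow ?V \<and> v \<in> S. ?c (card S) * ?b (n - card S))" by simp
  also have "\<dots> = (\<Sum>S\<in>Pow ?V. \<Sum>v | v \<in> ?V \<and> v \<in> S. ?c (card S) * ?b (n - card S))"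
    by (rule sum.swap_restrict) auto
  also have "\<dots> = (\<Sum>S\<in>Pow ?V. card S * ?c (card S) * ?b (n - card S))"
  proof (rule sum.cong)
    fix S assume "S \<in> Pow ?V"
    then have "{v. v \<in> ?V \<and> v \<in> S} = S" by auto
    then show "(\<Sum>v | v \<in> ?V \<and> v \<in> S. ?c (card S) * ?b (n - card S)) =
        card S * ?c (card S) * ?b (n - card S)" by simp
  qed simp
  also have "\<dots> = (\<Sum>k\<le>n. \<Sum>S | S \<in> Pow ?V \<and> card S = k. card S * ?c (card S) * ?b (n - card S))"
    by (rule sum.group[symmetric]) (use card_mono[of ?V] in auto)
  also have "\<dots> = (\<Sum>k\<le>n. (n choose k) * (k * ?c k * ?b (n - k)))"
  proof (rule sum.cong)
    fix k
    show "(\<Sum>S | S \<in> Pow ?V \<and> card S = k. card S * ?c (card S) * ?b (n - card S)) =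
        (n choose k) * (k * ?c k * ?b (n - k))"
      using n_subsets[of ?V k] by simp
  qed simp
  finally show ?thesis .
qed

section \<open>Partitions of an integer and the coefficients of an exponential\<close>

definition partitions :: "nat \<Rightarrow> nat multiset set" where
  "partitions n = {M. sum_mset M = n \<and> 0 \<notin># M}"

text \<open>The term belonging to \<open>M\<close> in the expansion of the exponential of the sum of
  all \<open>x k\<close>. Over \<open>partitions n\<close> these terms add up to the coefficient of
  \<open>t^n\<close> in \<open>exp (\<Sum>k. x k * t^k)\<close>.\<close>

definition exp_weight :: "('a \<Rightarrow> real) \<Rightarrow> 'a multiset \<Rightarrow> real" where
  "exp_weight x M = (\<Prod>k\<in>set_mset M. x k ^ count M k / fact (count M k))"

text \<open>Values outside \<open>M\<close> contribute \<open>x k ^ 0 / fact 0 = 1\<close>. This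
  lets multisets with different supports be compared over one index set.\<close>

lemma exp_weight_superset:
  assumes "finite A" "set_mset M \<subseteq> A"
  shows "exp_weight x M = (\<Prod>k\<in>A. x k ^ count M k / fact (count M k))"
  unfolding exp_weight_def
  by (rule prod.mono_neutral_left) (use assms in \<open>auto simp: not_in_iff\<close>)

lemma exp_weight_empty [simp]: "exp_weight x {#} = 1"
  by (simp add: exp_weight_def)

text \<open>Only the factor at \<open>k\<close> changes. The number on the left is the multiplicity
  of \<open>k\<close> in \<open>add_mset k N\<close>, which is the form needed for marking one
  part.\<close>

lemma exp_weight_add_mset:
  "real (Suc (count N k)) * exp_weight x (add_mset k N) = x k * exp_weight x N"
proof -
  let ?A = "insert k (set_mset N)" and ?t = "\<lambda>M j. x j ^ count M j / fact (count M j)"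
  have rest: "(\<Prod>j\<in>?A - {k}. ?t (add_mset k N) j) = (\<Prod>j\<in>?A - {k}. ?t N j)"
    by (rule prod.cong) auto
  have "exp_weight x (add_mset k N) = ?t (add_mset k N) k * (\<Prod>j\<in>?A - {k}. ?t N j)"
    unfolding rest[symmetric]
    by (subst exp_weight_superset[of ?A]) (auto simp only: finite_insert finite_set_mset insertI1
        set_mset_add_mset_insert intro!: prod.remove)
  moreover have "exp_weight x N = ?t N k * (\<Prod>j\<in>?A - {k}. ?t N j)"
    by (subst exp_weight_superset[of ?A]) (auto simp only: finite_insert finite_set_mset insertI1
        intro!: prod.remove)
  moreover have "real (Suc (count N k)) * ?t (add_mset k N) k = x k * ?t N k"
    by (simp del: of_nat_Suc)
  ultimately show ?thesis by (simp only: mult.assoc[symmetric])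
qed

lemma exp_weight_replicate_mset_plus:
  assumes "k \<notin># N"
  shows "exp_weight x (replicate_mset m k + N) = x k ^ m / fact m * exp_weight x N"
proof (induction m)
  case (Suc m)
  have "real (Suc m) * exp_weight x (replicate_mset (Suc m) k + N) =
      x k * exp_weight x (replicate_mset m k + N)"
    using exp_weight_add_mset[of "replicate_mset m k + N" k x] assms by (simp add: not_in_iff)
  also have "\<dots> = real (Suc m) * (x k ^ Suc m / fact (Suc m) * exp_weight x N)"
    unfolding Suc.IH fact_Suc by simp
  finally show ?case unfolding mult_cancel_left by simp
qed simp

lemma sum_mset_eq_sum_count: "sum_mset M = (\<Sum>k\<in>set_mset M. count M k * k)" for M :: "nat multiset"
proof (induction M)
  case (add k M)
  have "(\<Sum>j\<in>set_mset (add_mset k M). count (add_mset k M) j * j) =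
      (\<Sum>j\<in>insert k (set_mset M). count M j * j + (if j = k then k else 0))"
    by (rule sum.cong) auto
  also have "\<dots> = (\<Sum>j\<in>insert k (set_mset M). count M j * j) + k"
    by (simp add: sum.distrib)
  also have "(\<Sum>j\<in>insert k (set_mset M). count M j * j) = (\<Sum>j\<in>set_mset M. count M j * j)"
    by (rule sum.mono_neutral_right) (auto simp: not_in_iff)
  finally show ?case using add by simp
qed simp

text \<open>Since the parts are positive, both their number and their sizes are at most
  \<open>n\<close>.\<close>

lemma finite_partitions: "finite (partitions n)"
proof (rule finite_subset)
  have "M \<in> mset ` {xs. set xs \<subseteq> {..n} \<and> length xs \<le> n}" if "M \<in> partitions n" for M
  proof -
    obtain xs where M: "M = mset xs" by (metis ex_mset)
    have "length xs \<le> sum_list xs" if "0 \<notin> set xs" for xs :: "nat list"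
      using that by (induction xs) auto
    then show ?thesis
      using that member_le_sum_list[of _ xs] unfolding M partitions_def
      by (auto simp: sum_mset_sum_list)
  qed
  then show "partitions n \<subseteq> mset ` {xs. set xs \<subseteq> {..n} \<and> length xs \<le> n}" by blast
  show "finite (mset ` {xs. set xs \<subseteq> {..n} \<and> length xs \<le> n})"
    by (intro finite_imageI finite_lists_length_le) simp
qed

lemma partitions_0: "partitions 0 = {{#}}"
proof -
  have "M = {#}" if "sum_mset M = 0" "0 \<notin># M" for M :: "nat multiset"
    using that by (cases M) auto
  then show ?thesis by (auto simp: partitions_def)
qed

text \<open>Coefficient form of \<open>t F' = (t G') F\<close> for \<open>F = exp G\<close>. The
  factor \<open>n\<close> is written as the sum of the parts of \<open>M\<close>, each value
  weighted by its multiplicity, which marks a part.\<close>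

lemma sum_exp_weight_recurrence:
  "real n * (\<Sum>M\<in>partitions n. exp_weight x M) =
    (\<Sum>k\<in>{1..n}. real k * x k * (\<Sum>M\<in>partitions (n - k). exp_weight x M))"
proof -
  have "real n * (\<Sum>M\<in>partitions n. exp_weight x M) =
      (\<Sum>M\<in>partitions n. \<Sum>k\<in>set_mset M. real k * (real (count M k) * exp_weight x M))"
    unfolding sum_distrib_left
  proof (rule sum.cong)
    fix M assume "M \<in> partitions n"
    then have "real n = (\<Sum>k\<in>set_mset M. real k * real (count M k))"
      by (auto simp: partitions_def sum_mset_eq_sum_count mult.commute)
    then show "real n * exp_weight x M =
        (\<Sum>k\<in>set_mset M. real k * (real (count M k) * exp_weight x M))"
      by (simp add: sum_distrib_right mult.assoc)
  qed simp
  also have "\<dots> = (\<Sum>(M, k)\<in>(SIGMA M:partitions n. set_mset M).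
      real k * (real (count M k) * exp_weight x M))"
    by (rule sum.Sigma[OF finite_partitions]) simp
  \<comment> \<open>Deleting one copy of the marked value \<open>k\<close> leaves a partition of
    \<open>n - k\<close>, and inserting it again is the inverse; the multiplicity is absorbed by
    \<open>exp_weight_add_mset\<close>.\<close>
  also have "\<dots> = (\<Sum>(k, N)\<in>(SIGMA k:{1..n}. partitions (n - k)). real k * x k * exp_weight x N)"
  proof (rule sum.reindex_bij_witness[where j = "\<lambda>(M, k). (k, M - {#k#})"
        and i = "\<lambda>(k, N). (add_mset k N, k)"]; clarify)
    fix M k assume M: "M \<in> partitions n" "k \<in># M"
    then show "k \<in> {1..n} \<and> M - {#k#} \<in> partitions (n - k)"
      by (auto simp: partitions_def sum_mset.remove Suc_le_eq dest: in_diffD intro: gr0I)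
    show "real k * x k * exp_weight x (M - {#k#}) = real k * (real (count M k) * exp_weight x M)"
      using exp_weight_add_mset[of "M - {#k#}" k x] M(2) by simp
  qed (auto simp: partitions_def)
  also have "\<dots> = (\<Sum>k\<in>{1..n}. \<Sum>N\<in>partitions (n - k). real k * x k * exp_weight x N)"
    by (rule sum.Sigma[symmetric]) (auto simp: finite_partitions)
  finally show ?thesis by (simp add: sum_distrib_left)
qed

section \<open>Expansions as multisets\<close>

text \<open>The underlying list is the one whose multinomial coefficient is taken in the
  theorem.\<close>

definition mset_of_expansion :: "(nat \<times> 'a) list \<Rightarrow> 'a multiset" where
  "mset_of_expansion e = mset (concat (map (\<lambda>(m, k). replicate m k) e))"

text \<open>The reversal matches the decreasing order of the values in
  \<open>expansions\<close>.\<close>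

definition expansion_of_mset :: "'a::linorder multiset \<Rightarrow> (nat \<times> 'a) list" where
  "expansion_of_mset M = map (\<lambda>k. (count M k, k)) (rev (sorted_list_of_set (set_mset M)))"

lemma mset_of_expansion_Nil [simp]: "mset_of_expansion [] = {#}"
  and mset_of_expansion_Cons [simp]:
    "mset_of_expansion ((m, k) # e) = replicate_mset m k + mset_of_expansion e"
  by (simp_all add: mset_of_expansion_def)

lemma set_mset_of_expansion:
  "\<forall>(m, k)\<in>set e. m > 0 \<Longrightarrow> set_mset (mset_of_expansion e) = snd ` set e"
proof (induction e)
  case (Cons p e)
  then show ?case by (cases p) simp
qed simp

lemma count_mset_of_expansion:
  "distinct (map snd e) \<Longrightarrow> (m, k) \<in> set e \<Longrightarrow> count (mset_of_expansion e) k = m"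
proof (induction e)
  case (Cons p e)
  have "count (mset_of_expansion e) k = 0" if "k \<notin> snd ` set e" for e :: "(nat \<times> 'a) list" and k
    using that by (induction e) auto
  with Cons show ?case by (cases p) force
qed simp

lemma sum_mset_of_expansion:
  "sum_mset (mset_of_expansion e) = (\<Sum>(m, k)\<leftarrow>e. m * k)" for e :: "(nat \<times> nat) list"
  by (induction e) auto

text \<open>As the values are distinct, each pair adds a block of a value not yet present, so the
  weight splits off one factor per pair.\<close>

lemma exp_weight_mset_of_expansion:
  assumes "distinct (map snd e)"
  shows "exp_weight x (mset_of_expansion e) = (\<Prod>(m, k)\<leftarrow>e. x k ^ m / fact m)"
  using assms
proof (induction e)
  case (Cons p e)
  obtain m k where p: "p = (m, k)" by (cases p)
  have "set_mset (mset_of_expansion e) \<subseteq> snd ` set e"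
    by (auto simp: mset_of_expansion_def split: if_splits) force
  then have "k \<notin># mset_of_expansion e" using Cons.prems p by auto
  then show ?case using Cons p by (simp add: exp_weight_replicate_mset_plus)
qed simp

lemma mset_of_expansion_of_mset: "mset_of_expansion (expansion_of_mset M) = M"
proof -
  have "count (mset_of_expansion (map (\<lambda>k. (count M k, k)) ks)) j = (if j \<in> set ks then count M j else 0)"
    if "distinct ks" for ks j
    using that by (induction ks) auto
  then show ?thesis
    by (intro multiset_eqI) (simp add: expansion_of_mset_def not_in_iff)
qed

lemma expansion_of_mset_of_expansion:
  assumes "sorted_wrt (>) (map snd e)" "\<forall>(m, k)\<in>set e. m > 0"
  shows "expansion_of_mset (mset_of_expansion e) = e"
proof -
  have s: "sorted_wrt (<) (rev (map snd e))"
    using assms(1) by (simp add: sorted_wrt_rev)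
  then have dist: "distinct (map snd e)"
    using strict_sorted_iff by (metis distinct_rev)
  \<comment> \<open>A strictly increasing list is determined by its set of elements.\<close>
  have "sorted_list_of_set (snd ` set e) = rev (map snd e)"
    using s distinct_card[OF dist] by (intro sorted_list_of_set_unique[THEN iffD1]) auto
  then have "expansion_of_mset (mset_of_expansion e) =
      map (\<lambda>p. (count (mset_of_expansion e) (snd p), snd p)) e"
    by (simp add: expansion_of_mset_def set_mset_of_expansion[OF assms(2)] rev_map comp_def)
  also have "\<dots> = e"
    by (rule map_idI) (auto simp: count_mset_of_expansion[OF dist])
  finally show ?thesis .
qed

lemma bij_betw_expansions_partitions:
  assumes "n > 0"
  shows "bij_betw mset_of_expansion (expansions n) (partitions n)"
proof (rule bij_betw_byWitness[where f' = expansion_of_mset])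
  show "\<forall>e\<in>expansions n. expansion_of_mset (mset_of_expansion e) = e"
    by (auto simp: expansions_def intro!: expansion_of_mset_of_expansion)
  show "\<forall>M\<in>partitions n. mset_of_expansion (expansion_of_mset M) = M"
    by (simp add: mset_of_expansion_of_mset)
  show "mset_of_expansion ` expansions n \<subseteq> partitions n"
  proof clarify
    fix e assume e: "e \<in> expansions n"
    then have "set_mset (mset_of_expansion e) = snd ` set e"
      by (intro set_mset_of_expansion) (auto simp: expansions_def)
    with e show "mset_of_expansion e \<in> partitions n"
      by (auto simp: partitions_def sum_mset_of_expansion expansions_def)
  qed
  show "expansion_of_mset ` partitions n \<subseteq> expansions n"
  proof clarify
    fix M assume M: "M \<in> partitions n"
    let ?e = "expansion_of_mset M"
    have "map snd ?e = rev (sorted_list_of_set (set_mset M))"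
      by (simp add: expansion_of_mset_def comp_def)
    then have "sorted_wrt (>) (map snd ?e)" by (simp add: sorted_wrt_rev)
    moreover have "(\<Sum>(m, k)\<leftarrow>?e. m * k) = n"
      using M by (simp add: sum_mset_of_expansion[symmetric] mset_of_expansion_of_mset partitions_def)
    moreover have "\<forall>(m, k)\<in>set ?e. m > 0 \<and> k > 0"
      using M by (auto simp: expansion_of_mset_def partitions_def intro: gr0I)
    \<comment> \<open>\<open>n > 0\<close> rules out the empty list, whose sum is 0.\<close>
    ultimately show "?e \<in> expansions n" using assms by (auto simp: expansions_def)
  qed
qed

section \<open>Solving the recurrence and translating back to expansions\<close>

text \<open>Both sides satisfy the same recurrence and equal 1 at \<open>n = 0\<close>, where the
  only covering is \<open>{}\<close> and the only partition is \<open>{#}\<close>.\<close>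

lemma card_coverings_eq_sum_partitions:
  "real (card (coverings {1..n})) / fact n =
    (\<Sum>M\<in>partitions n. exp_weight (\<lambda>k. real (card (connected_coverings {1..k})) / fact k) M)"
proof (induction n rule: less_induct)
  case (less n)
  let ?c = "\<lambda>k. card (connected_coverings {1..k})" and ?b = "\<lambda>k. card (coverings {1..k})"
  let ?x = "\<lambda>k. real (?c k) / fact k"
  show ?case
  proof (cases "n = 0")
    case True
    then show ?thesis by (simp add: coverings_empty partitions_0)
  next
    case False
    have "real n * (real (?b n) / fact n) =
        (\<Sum>k\<le>n. real (n choose k) * (real k * real (?c k) * real (?b (n - k)))) / fact n"
      using arg_cong[OF card_coverings_recurrence[of n], of real] by simp
    also have "\<dots> = (\<Sum>k\<le>n. real k * ?x k * (real (?b (n - k)) / fact (n - k)))"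
      unfolding sum_divide_distrib by (rule sum.cong) (auto simp: binomial_fact field_simps)
    \<comment> \<open>The factor \<open>k\<close> kills the term at 0, leaving only indices
      \<open>n - k < n\<close>, to which the induction hypothesis applies.\<close>
    also have "\<dots> = (\<Sum>k\<in>{1..n}. real k * ?x k * (real (?b (n - k)) / fact (n - k)))"
      by (rule sum.mono_neutral_right) auto
    also have "\<dots> = (\<Sum>k\<in>{1..n}. real k * ?x k * (\<Sum>M\<in>partitions (n - k). exp_weight ?x M))"
      using less by (intro sum.cong) auto
    also have "\<dots> = real n * (\<Sum>M\<in>partitions n. exp_weight ?x M)"
      by (rule sum_exp_weight_recurrence[symmetric])
    finally show ?thesis using False unfolding mult_cancel_left by simp
  qed
qed

lemma multinomial_expansion:
  "multinomial n (concat (map (\<lambda>(m, k). replicate m k) e)) = fact n / (\<Prod>(m, k)\<leftarrow>e. fact k ^ m)"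
proof -
  have "(\<Prod>k\<leftarrow>concat (map (\<lambda>(m, k). replicate m k) e). fact k :: real) = (\<Prod>(m, k)\<leftarrow>e. fact k ^ m)"
    by (induction e) auto
  then show ?thesis by (simp add: multinomial_def)
qed

text \<open>The powers of \<open>fact k\<close> in the denominators combine with
  \<open>fact n\<close> into the multinomial coefficient; the factorials of the multiplicities
  remain.\<close>

lemma exp_weight_expansion:
  assumes "e \<in> expansions n"
  shows "fact n * exp_weight (\<lambda>k. real (card (connected_coverings {1..k})) / fact k) (mset_of_expansion e) =
    1 / (\<Prod>(m, k)\<leftarrow>e. fact m)
    * multinomial n (concat (map (\<lambda>(m, k). replicate m k) e))
    * (\<Prod>(m, k)\<leftarrow>e. real (card (connected_antichains k)) ^ m)"
proof -
  let ?c = "\<lambda>k. card (connected_coverings {1..k})"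
  have "sorted_wrt (<) (rev (map snd e))" and pos: "\<forall>(m, k)\<in>set e. k > 0"
    using assms by (auto simp: expansions_def sorted_wrt_rev)
  then have dist: "distinct (map snd e)"
    using strict_sorted_iff by (metis distinct_rev)
  have "(\<Prod>(m, k)\<leftarrow>e. real (card (connected_antichains k)) ^ m) = (\<Prod>(m, k)\<leftarrow>e. real (?c k) ^ m)"
    using pos by (intro arg_cong[of _ _ prod_list] map_cong)
      (auto simp: connected_antichains_eq_connected_coverings)
  moreover have "(\<Prod>(m, k)\<leftarrow>e. (real (?c k) / fact k) ^ m / fact m) =
      (\<Prod>(m, k)\<leftarrow>e. real (?c k) ^ m) / ((\<Prod>(m, k)\<leftarrow>e. fact m) * (\<Prod>(m, k)\<leftarrow>e. fact k ^ m))"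
    by (induction e) (auto simp: power_divide)
  ultimately show ?thesis
    by (simp add: exp_weight_mset_of_expansion[OF dist] multinomial_expansion)
qed

theorem theorem6p6:
  fixes n :: nat
  assumes "n > 0"
  shows "real (card (basic_interval n)) =
    (\<Sum>e\<in>expansions n.
       1 / (\<Prod>(m, k)\<leftarrow>e. fact m)
       * multinomial n (concat (map (\<lambda>(m, k). replicate m k) e))
       * (\<Prod>(m, k)\<leftarrow>e. real (card (connected_antichains k)) ^ m))"
proof -
  let ?x = "\<lambda>k. real (card (connected_coverings {1..k})) / fact k"
  have "real (card (basic_interval n)) = fact n * (\<Sum>M\<in>partitions n. exp_weight ?x M)"
    unfolding card_coverings_eq_sum_partitions[symmetric] basic_interval_eq_coverings[OF assms] by simp
  also have "\<dots> = (\<Sum>e\<in>expansions n. fact n * exp_weight ?x (mset_of_expansion e))"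
    unfolding sum_distrib_left
    by (rule sum.reindex_bij_betw[OF bij_betw_expansions_partitions[OF assms], symmetric])
  also have "\<dots> = (\<Sum>e\<in>expansions n.
       1 / (\<Prod>(m, k)\<leftarrow>e. fact m)
       * multinomial n (concat (map (\<lambda>(m, k). replicate m k) e))
       * (\<Prod>(m, k)\<leftarrow>e. real (card (connected_antichains k)) ^ m))"
    by (rule sum.cong[OF refl], rule exp_weight_expansion)
  finally show ?thesis .
qed

end
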